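(* Let $(X,d,W,\eta)$ be a complete nonempty $UCW$-hyperbolic space, let $b>0$ be an upper bound for its diameter, let $(k_n)\subseteq[0,\infty)$ with $\lim_{n\to\infty}k_n=0$, and let $T:X\to X$ be asymptotically nonexpansive with respect to $(k_n)$. Let $S:X\to X$ be the mapping constructed from $T$ in the context or, more generally, any mapping satisfying properties (i), (ii), (iii) of the context. Let $x\in X$, and let $(y_j)_{j\ge1}$ and $(x_k)_{k\ge1}$ be the sequences constructed from $S$ and $x$ in the context. Then $(x_k)$ converges to a point $p$ with $p\in Fix(S)=Fix(T)$, and the sequence $(y_j)$ converges to $p$.
   Context: A $W$-hyperbolic space is a triple $(X,d,W)$ where $(X,d)$ is a metric space and $W:X^2\times[0,1]\to X$ is such that for all $x,y,z,w\in X$ and $\lambda,\mu\in[0,1]$: (W1) $d(z,W(x,y,\lambda))\le(1-\lambda)d(z,x)+\lambda d(z,y)$; (W2) $d(W(x,y,\lambda),W(x,y,\mu))=|\lambda-\mu|d(x,y)$; (W3) $W(x,y,\lambda)=W(y,x,1-\lambda)$; (W4) $d(W(x,z,\lambda),W(y,w,\lambda))\le(1-\lambda)d(x,y)+\lambda d(z,w)$. We write $\frac{x+y}2$ for $W(x,y,\frac12)$. A modulus of uniform convexity for $(X,d,W)$ is a function $\eta:(0,\infty)\times(0,\infty)\to(0,1]$ such that for all $r,\varepsilon>0$ and $a,x,y\in X$ with $d(x,a)\le r$, $d(y,a)\le r$, $d(x,y)\ge\varepsilon r$ one has $d\left(\frac{x+y}2,a\right)\le(1-\eta(r,\varepsilon))r$.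 It is monotone if $\eta(r,\varepsilon)\le\eta(s,\varepsilon)$ whenever $r,s,\varepsilon>0$ and $s\le r$. A $UCW$-hyperbolic space is a quadruple $(X,d,W,\eta)$ where $(X,d,W)$ is a $W$-hyperbolic space and $\eta$ is a monotone modulus of uniform convexity for it. $T:X\to X$ is asymptotically nonexpansive with respect to $(k_n)$ if $d(T^nx,T^ny)\le(1+k_n)d(x,y)$ for all $x,y\in X$, $n\in\mathbb N$. $Fix(\cdot)$ denotes the set of fixed points of a self-mapping. By a known theorem of Kohlenbach and Leuştean, any asymptotically nonexpansive self-mapping of a bounded complete nonempty $UCW$-hyperbolic space has a fixed point, so $Fix(T)\ne\emptyset$. Mapping $S$ constructed from $T$. Let $x\in X$. If $Tx=x$, put $Sx:=x$. If $Tx\ne x$, let $n$ be minimal such that $k_n$ and $k_{n+1}$ are both smaller than or equal to $\min\left(\frac{d(x,Tx)}{2b},\,2\eta\left(b,\frac{d(x,Tx)}{2b}\right)\right)>0$ (such an $n$ exists since $k_n\to0$), let $m\in\{n,n+1\}$ be minimal such that $d(T^mx,x)\ge\frac1{2+k_1}d(Tx,x)$ (such an $m$ always exists), and put $Sx:=\frac{T^mx+x}2$. Properties of $S:X\to X$: (i) $Fix(T)=Fix(S)$ (so $Fix(S)\neq\emptyset$); (ii) for all $p\in Fix(S)$ and $x\in X$, $d(Sx,p)\le d(x,p)$; (iii) for any sequence $(x_n)\subseteq X$ with limit $x\in X$ and with $\lim_{n\to\infty}d(x_n,Sx_n)=0$, one has $x\in Fix(S)$. Construction from $S$ and $x\in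 X$. For each $j\ge1$ define an integer $m_j\ge1$ and a finite sequence $(z_{ij})_{i=1}^{m_j}$ in $X$, and put $y_j:=z_{m_jj}$, recursively: $m_1:=1$, $z_{11}:=x$. Given the $j$th finite sequence: (Case I) If there is an $i\in[2,m_j-1]$ with $d(z_{ij},z_{(i+1)j})<d(z_{ij},z_{(i-1)j})$ and $d\left(z_{ij},\frac{z_{ij}+Sz_{m_jj}}2\right)\ge d(z_{ij},z_{(i-1)j})$, let $i$ be the minimal such; put $m_{j+1}:=i+1$, $z_{k(j+1)}:=z_{kj}$ for all $k\le i$, and $z_{(i+1)(j+1)}:=\frac{z_{ij}+Sz_{m_jj}}2$. (Case II) If there is no such $i$, put $m_{j+1}:=m_j+1$, $z_{k(j+1)}:=z_{kj}$ for all $k\le m_j$, and $z_{(m_j+1)(j+1)}:=\frac{z_{m_jj}+Sz_{m_jj}}2$. There is a uniquely determined sequence $1=p_1<p_2<\dots$ such that for every $k\ge1$: $m_{p_k}=k$; for all $j\ge p_k+1$, $m_j\ge k+1$ and $z_{kj}=z_{kp_k}$; and either $z_{k(p_k-1)}$ is not defined or $z_{k(p_k-1)}\ne z_{kp_k}$. Put $x_k:=y_{p_k}=z_{kp_k}$ for $k\ge1$.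
   Formalization: For the mapping S constructed from T, property (ii), d(Sx,p) ≤ d(x,p) for p in Fix(S), is assumed rather than derived, because with the constants as printed it can fail; (i) and (iii) are proved for this S. *)

theory Defs
  imports "HOL-Analysis.Analysis"
begin

text \<open>
  The space \<open>X\<close> is the whole carrier type, so it is automatically nonempty. The functions \<open>W\<close> and
  \<open>\<eta>\<close> are total in HOL; they are only constrained on \<open>[0,1]\<close> (third argument of \<open>W\<close>)
  and on positive arguments (for \<open>\<eta>\<close>), and their values elsewhere are irrelevant.
\<close>

definition W_hyperbolic :: "('a::metric_space \<Rightarrow> 'a \<Rightarrow> real \<Rightarrow> 'a) \<Rightarrow> bool" where
  "W_hyperbolic W \<longleftrightarrow>
     (\<forall>x y z. \<forall>l\<in>{0..1}. dist z (W x y l) \<le> (1 - l) * dist z x + l * dist z y) \<and>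
     (\<forall>x y. \<forall>l\<in>{0..1}. \<forall>m\<in>{0..1}. dist (W x y l) (W x y m) = \<bar>l - m\<bar> * dist x y) \<and>
     (\<forall>x y. \<forall>l\<in>{0..1}. W x y l = W y x (1 - l)) \<and>
     (\<forall>x y z w. \<forall>l\<in>{0..1}. dist (W x z l) (W y w l) \<le> (1 - l) * dist x y + l * dist z w)"

definition midpt :: "('a \<Rightarrow> 'a \<Rightarrow> real \<Rightarrow> 'a) \<Rightarrow> 'a \<Rightarrow> 'a \<Rightarrow> 'a" where
  "midpt W x y = W x y (1 / 2)"

definition modulus_uc ::
  "('a::metric_space \<Rightarrow> 'a \<Rightarrow> real \<Rightarrow> 'a) \<Rightarrow> (real \<Rightarrow> real \<Rightarrow> real) \<Rightarrow> bool" where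
  "modulus_uc W \<eta> \<longleftrightarrow>
     (\<forall>r>0. \<forall>\<epsilon>>0. 0 < \<eta> r \<epsilon> \<and> \<eta> r \<epsilon> \<le> 1 \<and>
        (\<forall>a x y. dist x a \<le> r \<longrightarrow> dist y a \<le> r \<longrightarrow> dist x y \<ge> \<epsilon> * r \<longrightarrow>
           dist (midpt W x y) a \<le> (1 - \<eta> r \<epsilon>) * r))"

definition monotone_modulus :: "(real \<Rightarrow> real \<Rightarrow> real) \<Rightarrow> bool" where
  "monotone_modulus \<eta> \<longleftrightarrow> (\<forall>r>0. \<forall>s>0. \<forall>\<epsilon>>0. s \<le> r \<longrightarrow> \<eta> r \<epsilon> \<le> \<eta> s \<epsilon>)"

definition UCW_hyperbolic ::
  "('a::metric_space \<Rightarrow> 'a \<Rightarrow> real \<Rightarrow> 'a) \<Rightarrow> (real \<Rightarrow> real \<Rightarrow> real) \<Rightarrow> bool" where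
  "UCW_hyperbolic W \<eta> \<longleftrightarrow> W_hyperbolic W \<and> modulus_uc W \<eta> \<and> monotone_modulus \<eta>"

definition asymp_nonexpansive :: "(nat \<Rightarrow> real) \<Rightarrow> ('a::metric_space \<Rightarrow> 'a) \<Rightarrow> bool" where
  "asymp_nonexpansive k T \<longleftrightarrow>
     (\<forall>n x y. dist ((T ^^ n) x) ((T ^^ n) y) \<le> (1 + k n) * dist x y)"

definition Fix :: "('a \<Rightarrow> 'a) \<Rightarrow> 'a set" where
  "Fix T = {x. T x = x}"

text \<open>
  The averaged mapping built from \<open>T\<close>. Its index \<open>n\<close> ranges over all natural numbers including
  \<open>0\<close>. As \<open>k 0\<close> is an arbitrary nonnegative number here and the threshold never
  exceeds \<open>2\<close>, taking \<open>k 0 > 2\<close> gives the variant in which \<open>n\<close> ranges over the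
  positive integers.
\<close>

definition avg_index ::
  "(real \<Rightarrow> real \<Rightarrow> real) \<Rightarrow> real \<Rightarrow> (nat \<Rightarrow> real) \<Rightarrow> ('a::metric_space \<Rightarrow> 'a) \<Rightarrow> 'a \<Rightarrow> nat" where
  "avg_index \<eta> b k T x =
     (let t = min (dist x (T x) / (2 * b)) (2 * \<eta> b (dist x (T x) / (2 * b)));
          n = (LEAST n. k n \<le> t \<and> k (n + 1) \<le> t)
      in LEAST m. m \<in> {n, n + 1} \<and> dist ((T ^^ m) x) x \<ge> 1 / (2 + k 1) * dist (T x) x)"

definition avg_map ::
  "('a::metric_space \<Rightarrow> 'a \<Rightarrow> real \<Rightarrow> 'a) \<Rightarrow> (real \<Rightarrow> real \<Rightarrow> real) \<Rightarrow> real \<Rightarrow> (nat \<Rightarrow> real)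
     \<Rightarrow> ('a \<Rightarrow> 'a) \<Rightarrow> 'a \<Rightarrow> 'a" where
  "avg_map W \<eta> b k T x =
     (if T x = x then x else midpt W ((T ^^ avg_index \<eta> b k T x) x) x)"

text \<open>
  The finite sequence \<open>(z_1, \<dots>, z_m)\<close> is the list \<open>zs\<close> with \<open>m = length zs\<close>, so
  \<open>z_i\<close> is the element \<open>zs ! (i - 1)\<close>.
\<close>

definition entry :: "'a list \<Rightarrow> nat \<Rightarrow> 'a" where
  "entry zs i = zs ! (i - 1)"

definition cut_at ::
  "('a::metric_space \<Rightarrow> 'a \<Rightarrow> real \<Rightarrow> 'a) \<Rightarrow> ('a \<Rightarrow> 'a) \<Rightarrow> 'a list \<Rightarrow> nat \<Rightarrow> bool" where
  "cut_at W S zs i \<longleftrightarrow>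
     i \<in> {2..length zs - 1} \<and>
     dist (entry zs i) (entry zs (i + 1)) < dist (entry zs i) (entry zs (i - 1)) \<and>
     dist (entry zs i) (midpt W (entry zs i) (S (entry zs (length zs))))
       \<ge> dist (entry zs i) (entry zs (i - 1))"

definition next_stage ::
  "('a::metric_space \<Rightarrow> 'a \<Rightarrow> real \<Rightarrow> 'a) \<Rightarrow> ('a \<Rightarrow> 'a) \<Rightarrow> 'a list \<Rightarrow> 'a list" where
  "next_stage W S zs =
     (let i = (if \<exists>i. cut_at W S zs i then LEAST i. cut_at W S zs i else length zs)
      in take i zs @ [midpt W (entry zs i) (S (entry zs (length zs)))])"

text \<open>
  The construction starts at stage \<open>1\<close>; stage \<open>0\<close> is empty, i.e. has no defined entries.
\<close>

fun stage ::
  "('a::metric_space \<Rightarrow> 'a \<Rightarrow> real \<Rightarrow> 'a) \<Rightarrow> ('a \<Rightarrow> 'a) \<Rightarrow> 'a \<Rightarrow> nat \<Rightarrow> 'a list" where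
  "stage W S x 0 = []"
| "stage W S x (Suc 0) = [x]"
| "stage W S x (Suc (Suc j)) = next_stage W S (stage W S x (Suc j))"

definition m_len ::
  "('a::metric_space \<Rightarrow> 'a \<Rightarrow> real \<Rightarrow> 'a) \<Rightarrow> ('a \<Rightarrow> 'a) \<Rightarrow> 'a \<Rightarrow> nat \<Rightarrow> nat" where
  "m_len W S x j = length (stage W S x j)"

definition z_ent ::
  "('a::metric_space \<Rightarrow> 'a \<Rightarrow> real \<Rightarrow> 'a) \<Rightarrow> ('a \<Rightarrow> 'a) \<Rightarrow> 'a \<Rightarrow> nat \<Rightarrow> nat \<Rightarrow> 'a" where
  "z_ent W S x i j = entry (stage W S x j) i"

definition y_seq ::
  "('a::metric_space \<Rightarrow> 'a \<Rightarrow> real \<Rightarrow> 'a) \<Rightarrow> ('a \<Rightarrow> 'a) \<Rightarrow> 'a \<Rightarrow> nat \<Rightarrow> 'a" where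
  "y_seq W S x j = z_ent W S x (m_len W S x j) j"

text \<open>
  The sequence \<open>1 = p_1 < p_2 < \<dots>\<close> is a function on all of \<open>nat\<close>; strict monotonicity
  and \<open>p 1 = 1\<close> force \<open>p 0 = 0\<close>, so the extra index does not affect uniqueness. The entry
  \<open>z_ent W S x k j\<close> is undefined precisely if \<open>k > m_len W S x j\<close> (for \<open>k \<ge> 1\<close>).
\<close>

definition settling ::
  "('a::metric_space \<Rightarrow> 'a \<Rightarrow> real \<Rightarrow> 'a) \<Rightarrow> ('a \<Rightarrow> 'a) \<Rightarrow> 'a \<Rightarrow> (nat \<Rightarrow> nat) \<Rightarrow> bool" where
  "settling W S x p \<longleftrightarrow>
     p 1 = 1 \<and> strict_mono p \<and>
     (\<forall>k\<ge>1.
        m_len W S x (p k) = k \<and>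
        (\<forall>j\<ge>p k + 1. m_len W S x j \<ge> k + 1 \<and> z_ent W S x k j = z_ent W S x k (p k)) \<and>
        (k > m_len W S x (p k - 1) \<or> z_ent W S x k (p k - 1) \<noteq> z_ent W S x k (p k)))"

definition p_idx ::
  "('a::metric_space \<Rightarrow> 'a \<Rightarrow> real \<Rightarrow> 'a) \<Rightarrow> ('a \<Rightarrow> 'a) \<Rightarrow> 'a \<Rightarrow> nat \<Rightarrow> nat" where
  "p_idx W S x = (THE p. settling W S x p)"

definition x_seq ::
  "('a::metric_space \<Rightarrow> 'a \<Rightarrow> real \<Rightarrow> 'a) \<Rightarrow> ('a \<Rightarrow> 'a) \<Rightarrow> 'a \<Rightarrow> nat \<Rightarrow> 'a" where
  "x_seq W S x k = y_seq W S x (p_idx W S x k)"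

end

theory Submission
  imports Defs
begin

text \<open>
  The stages are Fejer monotone: every new entry is the midpoint of an entry \<open>z\<close> and an image
  \<open>S w\<close>, where \<open>w\<close> ends a stage that contains \<open>z\<close>, and hence is at least as near to each fixed point
  of \<open>S\<close> as all the entries before it (\<open>stage_fejer\<close>). Thus both sequences converge to a fixed
  point as soon as \<open>x_seq\<close> comes arbitrarily close to it (\<open>convergence_of_approach\<close>), and the task
  is to find such a fixed point. If a given fixed point is not approached, uniform convexity
  forces the step lengths of \<open>x_seq\<close> to tend to zero (\<open>steps_vanish\<close>).

  The rule for cutting turns small steps into information on \<open>S\<close>. When a final step of \<open>x_seq\<close> is
  shorter than the step before it, this step was made by extension, so that its length is half
  the displacement of \<open>S\<close> at its starting point (\<open>shorter_step_uncut\<close>); and since no later stage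
  is cut there, all later values \<open>S (y j)\<close> lie within twice the previous step length of that point
  (\<open>shorter_step_confines\<close>). As the steps tend to zero, either there are infinitely many such
  steps, or the steps are eventually zero. In the first case the values \<open>S (y j)\<close> form a Cauchy
  sequence, and its limit is approached by entries whose displacement tends to zero, so it is
  fixed by \<open>S\<close>. In the second case the eventually constant value is fixed. This is \<open>stages_converge\<close>.

  Three ingredients surround this argument. That \<open>x_seq\<close> is well defined means that each entry
  changes only finitely often (\<open>br_eventually_ge\<close>, \<open>settling_exists\<close>). That \<open>S\<close> has a
  fixed point at all is shown for \<open>T\<close> by means of asymptotic centres (\<open>Fix_nonempty\<close>).
  For the averaged mapping, the displacement of \<open>T\<close> is at most a constant times that of \<open>S\<close>
  (\<open>avg_map_displacement\<close>), which gives both the equality of the fixed point sets and the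
  fact that limits of points with vanishing displacement are fixed.
\<close>

section \<open>Midpoints\<close>

lemma dist_midpt_le:
  assumes "W_hyperbolic W"
  shows "dist z (midpt W x y) \<le> (dist z x + dist z y) / 2"
proof -
  have "\<forall>l\<in>{0..1}. dist z (W x y l) \<le> (1 - l) * dist z x + l * dist z y"
    using assms unfolding W_hyperbolic_def by blast
  from bspec[OF this, of "1/2"] show ?thesis
    by (simp add: midpt_def field_simps)
qed

lemma dist_midpt_left:
  assumes "W_hyperbolic W"
  shows "dist x (midpt W x y) = dist x y / 2"
proof -
  have "\<forall>l\<in>{0..1}. dist x (W x y l) \<le> (1 - l) * dist x x + l * dist x y"
    using assms unfolding W_hyperbolic_def by blast
  from bspec[OF this, of 0] have start: "W x y 0 = x" by simp
  have "\<forall>l\<in>{0..1}. \<forall>m\<in>{0..1}. dist (W x y l) (W x y m) = \<bar>l - m\<bar> * dist x y"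
    using assms unfolding W_hyperbolic_def by blast
  from bspec[OF bspec[OF this, of 0], of "1/2"] start show ?thesis
    by (simp add: midpt_def)
qed

lemma midpt_commute:
  assumes "W_hyperbolic W"
  shows "midpt W x y = midpt W y x"
proof -
  have "\<forall>l\<in>{0..1}. W x y l = W y x (1 - l)"
    using assms unfolding W_hyperbolic_def by blast
  from bspec[OF this, of "1/2"] show ?thesis by (simp add: midpt_def)
qed

text \<open>
  Monotonicity of the modulus makes the contraction factor uniform over all radii up to \<open>R\<close>.
\<close>

lemma midpt_contraction:
  assumes "UCW_hyperbolic W \<eta>" and "0 < r" "r \<le> R" "0 < \<epsilon>"
    and "dist x a \<le> r" "dist y a \<le> r" "\<epsilon> * R \<le> dist x y"
  shows "dist (midpt W x y) a \<le> (1 - \<eta> R \<epsilon>) * r"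
proof -
  have "\<epsilon> * r \<le> dist x y"
    using assms mult_left_mono[of r R \<epsilon>] by linarith
  then have "dist (midpt W x y) a \<le> (1 - \<eta> r \<epsilon>) * r"
    using assms unfolding UCW_hyperbolic_def modulus_uc_def by blast
  also have "\<dots> \<le> (1 - \<eta> R \<epsilon>) * r"
  proof -
    have "\<eta> R \<epsilon> \<le> \<eta> r \<epsilon>"
      using assms unfolding UCW_hyperbolic_def monotone_modulus_def by auto
    then show ?thesis using assms(2) by simp
  qed
  finally show ?thesis .
qed

lemma modulus_pos:
  assumes "UCW_hyperbolic W \<eta>" "0 < r" "0 < \<epsilon>"
  shows "0 < \<eta> r \<epsilon>"
  using assms by (simp add: UCW_hyperbolic_def modulus_uc_def)

section \<open>Asymptotic centres and fixed points\<close>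

text \<open>
  If two points far apart were both almost asymptotic centres, uniform convexity would make their
  midpoint a strictly better one, beating the lower bound \<open>\<rho>\<close> on all asymptotic distances from
  the sequence \<open>s\<close>.
\<close>

lemma near_centres_close:
  fixes W :: "'a::metric_space \<Rightarrow> 'a \<Rightarrow> real \<Rightarrow> 'a" and s :: "nat \<Rightarrow> 'a"
  assumes ucw: "UCW_hyperbolic W \<eta>" and "0 \<le> \<rho>" and "0 < e"
    and least: "\<And>u r. \<forall>\<^sub>F n in sequentially. dist (s n) u \<le> r \<Longrightarrow> \<rho> \<le> r"
  obtains r where "\<rho> < r"
    and "\<And>u v. \<lbrakk>\<forall>\<^sub>F n in sequentially. dist (s n) u \<le> r; \<forall>\<^sub>F n in sequentially. dist (s n) v \<le> r\<rbrakk>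
          \<Longrightarrow> dist u v < e"
proof (cases "\<rho> = 0")
  case True
  have "dist u v < e"
    if "\<forall>\<^sub>F n in sequentially. dist (s n) u \<le> e / 3" "\<forall>\<^sub>F n in sequentially. dist (s n) v \<le> e / 3" for u v
  proof -
    from eventually_conj[OF that] obtain n where n: "dist (s n) u \<le> e / 3" "dist (s n) v \<le> e / 3"
      by (auto simp: eventually_sequentially)
    have "dist u v \<le> dist (s n) u + dist (s n) v" by (rule dist_triangle3)
    with n \<open>0 < e\<close> show ?thesis by linarith
  qed
  with True \<open>0 < e\<close> show ?thesis by (intro that[of "e / 3"]) auto
next
  case False
  then have "0 < \<rho>" using assms(2) by simp
  define R where "R = \<rho> + 1"
  define \<epsilon> where "\<epsilon> = e / R"
  define h where "h = \<eta> R \<epsilon>"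
  have "0 < R" using assms(2) by (simp add: R_def)
  then have "0 < \<epsilon>" "\<epsilon> * R = e" using \<open>0 < e\<close> by (auto simp: \<epsilon>_def)
  have "0 < h" unfolding h_def using modulus_pos[OF ucw \<open>0 < R\<close> \<open>0 < \<epsilon>\<close>] .
  \<comment> \<open>The radius must exceed \<open>\<rho>\<close> so little that shrinking it by \<open>1 - h\<close> takes it below \<open>\<rho>\<close>.\<close>
  define r where "r = \<rho> + min 1 (\<rho> * h / 2)"
  have r: "\<rho> < r" "r \<le> R" using \<open>0 < \<rho>\<close> \<open>0 < h\<close> by (auto simp: r_def R_def)
  have "(1 - h) * r < \<rho>"
  proof -
    have "r \<le> \<rho> + \<rho> * h / 2" by (simp add: r_def)
    moreover have "h * \<rho> < h * r" using r \<open>0 < h\<close> by simp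
    moreover have "0 < \<rho> * h" using \<open>0 < \<rho>\<close> \<open>0 < h\<close> by simp
    moreover have "(1 - h) * r = r - h * r" by (simp add: algebra_simps)
    ultimately show ?thesis by (simp only: mult.commute[of \<rho> h])
  qed
  have "dist u v < e"
    if u: "\<forall>\<^sub>F n in sequentially. dist (s n) u \<le> r" and v: "\<forall>\<^sub>F n in sequentially. dist (s n) v \<le> r" for u v
  proof (rule ccontr)
    assume "\<not> dist u v < e"
    then have far: "\<epsilon> * R \<le> dist u v" using \<open>\<epsilon> * R = e\<close> by simp
    have "\<forall>\<^sub>F n in sequentially. dist (s n) (midpt W u v) \<le> (1 - h) * r"
      using u v
    proof eventually_elim
      case (elim n)
      have "dist (midpt W u v) (s n) \<le> (1 - \<eta> R \<epsilon>) * r"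
      proof (rule midpt_contraction[OF ucw _ \<open>r \<le> R\<close> \<open>0 < \<epsilon>\<close> _ _ far])
        show "0 < r" using r \<open>0 < \<rho>\<close> by linarith
        show "dist u (s n) \<le> r" "dist v (s n) \<le> r" using elim by (simp_all add: dist_commute)
      qed
      then show ?case by (simp add: h_def dist_commute)
    qed
    from least[OF this] \<open>(1 - h) * r < \<rho>\<close> show False by simp
  qed
  with r show ?thesis by (intro that) auto
qed

text \<open>
  Points approaching the asymptotic radius form a Cauchy sequence; the centre \<open>c\<close> is their limit.
  The last conclusion expresses that every asymptotically minimizing sequence converges to \<open>c\<close>.
\<close>

lemma asymptotic_centre:
  fixes W :: "'a::complete_space \<Rightarrow> 'a \<Rightarrow> real \<Rightarrow> 'a" and s :: "nat \<Rightarrow> 'a"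
  assumes ucw: "UCW_hyperbolic W \<eta>" and bdd: "\<forall>\<^sub>F n in sequentially. dist (s n) u0 \<le> r0"
  obtains \<rho> c where "\<And>r. \<rho> < r \<Longrightarrow> \<forall>\<^sub>F n in sequentially. dist (s n) c \<le> r"
    and "\<And>e. 0 < e \<Longrightarrow>
          \<exists>r>\<rho>. \<forall>u. (\<forall>\<^sub>F n in sequentially. dist (s n) u \<le> r) \<longrightarrow> dist u c < e"
proof -
  define near where "near r u \<longleftrightarrow> (\<forall>\<^sub>F n in sequentially. dist (s n) u \<le> r)" for r u
  define A where "A = {r. \<exists>u. near r u}"
  define \<rho> where "\<rho> = Inf A"
  have nonneg: "0 \<le> r" if "r \<in> A" for r
  proof -
    from that obtain u n where "dist (s n) u \<le> r"
      by (auto simp: A_def near_def eventually_sequentially)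
    then show ?thesis using zero_le_dist[of "s n" u] by linarith
  qed
  have bb: "bdd_below A" using nonneg by (rule bdd_belowI)
  have ne: "A \<noteq> {}" using bdd by (auto simp: A_def near_def)
  have "0 \<le> \<rho>" unfolding \<rho>_def using ne nonneg by (rule cInf_greatest)
  have least: "\<rho> \<le> r" if "\<forall>\<^sub>F n in sequentially. dist (s n) u \<le> r" for u r
    unfolding \<rho>_def by (rule cInf_lower[OF _ bb]) (use that in \<open>auto simp: A_def near_def\<close>)
  have mono: "near r' u" if "near r u" "r \<le> r'" for r r' u
    using that(1) unfolding near_def by eventually_elim (use that(2) in simp)
  have ex: "\<exists>u. near r u" if r: "\<rho> < r" for r
  proof -
    obtain r' where "r' \<in> A" "r' < r"
      using r unfolding \<rho>_def by (meson cInf_less_iff[OF ne bb])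
    then show ?thesis using mono[of r' _ r] by (auto simp: A_def)
  qed
  have close: "\<exists>r>\<rho>. \<forall>u v. near r u \<longrightarrow> near r v \<longrightarrow> dist u v < e" if e: "0 < e" for e
  proof -
    obtain r where "\<rho> < r" "\<And>u v. near r u \<Longrightarrow> near r v \<Longrightarrow> dist u v < e"
      by (rule near_centres_close[OF ucw \<open>0 \<le> \<rho>\<close> e, of s]) (auto simp: near_def intro: least)
    then show ?thesis by blast
  qed
  define g where "g n = \<rho> + 1 / real (Suc n)" for n
  have "\<forall>n. \<exists>u. near (g n) u" using ex by (auto simp: g_def)
  then obtain f where f: "\<And>n. near (g n) (f n)" by metis
  have "(\<lambda>n. \<rho> + 1 / real (Suc n)) \<longlonglongrightarrow> \<rho> + 0"
    using LIMSEQ_inverse_real_of_nat by (intro tendsto_add tendsto_const) (simp add: inverse_eq_divide)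
  then have g: "g \<longlonglongrightarrow> \<rho>" by (simp add: g_def[abs_def])
  have ev: "\<forall>\<^sub>F n in sequentially. near r (f n)" if "\<rho> < r" for r
    using order_tendstoD(2)[OF g that] by eventually_elim (use f mono in \<open>blast intro: less_imp_le\<close>)
  have "Cauchy f"
  proof (rule metric_CauchyI)
    fix e :: real assume "0 < e"
    from close[OF this] obtain r where r: "r > \<rho>" "\<And>u v. near r u \<Longrightarrow> near r v \<Longrightarrow> dist u v < e" by blast
    from ev[OF r(1)] obtain N where "\<And>n. n \<ge> N \<Longrightarrow> near r (f n)" by (auto simp: eventually_sequentially)
    with r(2) show "\<exists>M. \<forall>m\<ge>M. \<forall>n\<ge>M. dist (f m) (f n) < e" by blast
  qed
  then obtain c where c: "f \<longlonglongrightarrow> c" using Cauchy_convergent by (auto simp: convergent_def)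
  have cen: "near r c" if "\<rho> < r" for r
  proof -
    define d where "d = (r - \<rho>) / 2"
    have d: "0 < d" "\<rho> < \<rho> + d" using that by (auto simp: d_def)
    from eventually_conj[OF ev[OF d(2)] tendstoD[OF c d(1)]]
    obtain n where n: "near (\<rho> + d) (f n)" "dist (f n) c < d" by (auto simp: eventually_sequentially)
    from n(1) show ?thesis unfolding near_def
    proof eventually_elim
      case (elim i)
      have "dist (s i) c \<le> dist (s i) (f n) + dist (f n) c" by (rule dist_triangle)
      with elim n(2) show ?case unfolding d_def by (simp add: field_simps)
    qed
  qed
  have "\<exists>r>\<rho>. \<forall>u. near r u \<longrightarrow> dist u c < e" if "0 < e" for e
    using close[OF that] cen by blast
  with cen show ?thesis by (intro that[of \<rho> c]) (auto simp: near_def)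
qed

lemma asymp_nonexpansive_tendsto:
  assumes "asymp_nonexpansive k T" and u: "u \<longlonglongrightarrow> w"
  shows "(\<lambda>n. T (u n)) \<longlonglongrightarrow> T w"
proof -
  have lip: "dist (T (u n)) (T w) \<le> (1 + k 1) * dist (u n) w" for n
    using assms(1)[unfolded asymp_nonexpansive_def, rule_format, of 1 "u n" w] by simp
  have "(\<lambda>n. (1 + k 1) * dist (u n) w) \<longlonglongrightarrow> 0"
    by (intro tendsto_mult_right_zero) (use u tendsto_dist_iff in blast)
  then have "(\<lambda>n. dist (T (u n)) (T w)) \<longlonglongrightarrow> 0"
    by (rule Lim_null_comparison[rotated]) (use lip in auto)
  then show ?thesis using tendsto_dist_iff by blast
qed

text \<open>
  Let \<open>c\<close> be the asymptotic centre of an orbit. Since \<open>T ^^ m\<close> expands distances by at most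
  \<open>1 + k m\<close>, the points \<open>(T ^^ m) c\<close> are asymptotically as good as \<open>c\<close>, so they converge to
  \<open>c\<close>; continuity of \<open>T\<close> then gives \<open>T c = c\<close>.
\<close>

lemma Fix_nonempty:
  fixes W :: "'a::complete_space \<Rightarrow> 'a \<Rightarrow> real \<Rightarrow> 'a"
    and T :: "'a \<Rightarrow> 'a"
  assumes ucw: "UCW_hyperbolic W \<eta>" and bdd: "\<forall>u v :: 'a. dist u v \<le> b"
    and k: "\<forall>n. k n \<ge> 0" "k \<longlonglongrightarrow> 0" and T: "asymp_nonexpansive k T"
  shows "Fix T \<noteq> {}"
proof -
  fix x0 :: 'a
  define s where "s n = (T ^^ n) x0" for n
  obtain \<rho> c
    where c: "\<And>r. \<rho> < r \<Longrightarrow> \<forall>\<^sub>F n in sequentially. dist (s n) c \<le> r"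
    and close: "\<And>e. 0 < e \<Longrightarrow>
          \<exists>r>\<rho>. \<forall>u. (\<forall>\<^sub>F n in sequentially. dist (s n) u \<le> r) \<longrightarrow> dist u c < e"
    by (rule asymptotic_centre[OF ucw, of s x0 b]) (use bdd in auto)
  have shift: "\<forall>\<^sub>F n in sequentially. dist (s n) ((T ^^ m) c) \<le> (1 + k m) * r" if r: "\<rho> < r" for r m
  proof -
    have "\<forall>\<^sub>F n in sequentially. dist (s (n + m)) ((T ^^ m) c) \<le> (1 + k m) * r"
      using c[OF r]
    proof eventually_elim
      case (elim n)
      have "dist (s (n + m)) ((T ^^ m) c) = dist ((T ^^ m) (s n)) ((T ^^ m) c)"
        by (simp add: s_def funpow_add add.commute[of n m])
      also have "\<dots> \<le> (1 + k m) * dist (s n) c"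
        using T unfolding asymp_nonexpansive_def by blast
      also have "\<dots> \<le> (1 + k m) * r"
        using elim k(1) by (intro mult_left_mono) (auto simp: add_nonneg_nonneg)
      finally show ?case .
    qed
    then show ?thesis
      using eventually_sequentially_seg[of "\<lambda>n. dist (s n) ((T ^^ m) c) \<le> (1 + k m) * r" m] by simp
  qed
  have lim: "(\<lambda>m. (T ^^ m) c) \<longlonglongrightarrow> c"
  proof (rule tendstoI)
    fix e :: real assume "0 < e"
    from close[OF this] obtain r where r: "\<rho> < r"
      and rc: "\<And>u. (\<forall>\<^sub>F n in sequentially. dist (s n) u \<le> r) \<Longrightarrow> dist u c < e" by blast
    define r' where "r' = (\<rho> + r) / 2"
    have r': "\<rho> < r'" "r' < r" using r by (auto simp: r'_def)
    have "(\<lambda>m. (1 + k m) * r') \<longlonglongrightarrow> (1 + 0) * r'" by (intro tendsto_intros k(2))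
    then have "\<forall>\<^sub>F m in sequentially. (1 + k m) * r' < r" using order_tendstoD(2)[of _ r'] r' by simp
    then show "\<forall>\<^sub>F m in sequentially. dist ((T ^^ m) c) c < e"
    proof eventually_elim
      case (elim m)
      show ?case
        by (rule rc) (use shift[OF r'(1), of m] elim in \<open>auto elim: eventually_mono\<close>)
    qed
  qed
  have "(\<lambda>m. T ((T ^^ m) c)) \<longlonglongrightarrow> T c" by (rule asymp_nonexpansive_tendsto[OF T lim])
  moreover have "(\<lambda>m. T ((T ^^ m) c)) \<longlonglongrightarrow> c" using LIMSEQ_Suc[OF lim] by simp
  ultimately have "T c = c" by (rule LIMSEQ_unique)
  then show ?thesis by (auto simp: Fix_def)
qed

section \<open>The averaged mapping\<close>

text \<open>
  Of two consecutive iterates of \<open>T\<close>, at least one moves \<open>u\<close> by a fixed fraction of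
  \<open>dist u (T u)\<close>: if \<open>(T ^^ n) u\<close> is close to \<open>u\<close>, then \<open>(T ^^ (n + 1)) u\<close> is close to \<open>T u\<close>,
  and so it cannot be close to \<open>u\<close>. The averaged mapping moves \<open>u\<close> halfway to the
  iterate chosen.
\<close>

lemma avg_map_displacement:
  fixes W :: "'a::metric_space \<Rightarrow> 'a \<Rightarrow> real \<Rightarrow> 'a" and T :: "'a \<Rightarrow> 'a"
  assumes ucw: "UCW_hyperbolic W \<eta>" and "b > 0"
    and k: "\<forall>n. k n \<ge> 0" "k \<longlonglongrightarrow> 0" and T: "asymp_nonexpansive k T"
  shows "dist u (T u) \<le> 2 * (2 + k 1) * dist u (avg_map W \<eta> b k T u)"
proof (cases "T u = u")
  case True
  then show ?thesis by (simp add: avg_map_def)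
next
  case False
  have W: "W_hyperbolic W" using ucw by (simp add: UCW_hyperbolic_def)
  define c where "c = 1 / (2 + k 1) * dist (T u) u"
  have k1: "0 \<le> k 1" using k(1) by blast
  define n where "n = (LEAST n. k n \<le> min (dist u (T u) / (2 * b)) (2 * \<eta> b (dist u (T u) / (2 * b))) \<and>
        k (n + 1) \<le> min (dist u (T u) / (2 * b)) (2 * \<eta> b (dist u (T u) / (2 * b))))"
  define m where "m = avg_index \<eta> b k T u"
  have m_eq: "m = (LEAST m. m \<in> {n, n + 1} \<and> c \<le> dist ((T ^^ m) u) u)"
    unfolding m_def avg_index_def Let_def n_def c_def by simp
  have "\<exists>m. m \<in> {n, n + 1} \<and> c \<le> dist ((T ^^ m) u) u"
  proof (rule ccontr)
    assume "\<not> ?thesis"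
    then have small: "dist ((T ^^ n) u) u < c" "dist ((T ^^ (n + 1)) u) u < c" by force+
    have "dist (T u) u \<le> dist (T u) ((T ^^ (n + 1)) u) + dist ((T ^^ (n + 1)) u) u"
      by (rule dist_triangle)
    also have "dist (T u) ((T ^^ (n + 1)) u) \<le> (1 + k 1) * dist u ((T ^^ n) u)"
      using T[unfolded asymp_nonexpansive_def, rule_format, of 1 u "(T ^^ n) u"] by simp
    also have "\<dots> \<le> (1 + k 1) * c"
      using small k1 by (intro mult_left_mono) (auto simp: dist_commute)
    finally have "dist (T u) u < (1 + k 1) * c + c" using small by linarith
    also have "\<dots> = (2 + k 1) * c" by (simp add: algebra_simps)
    also have "\<dots> = dist (T u) u" using k1 by (simp add: c_def)
    finally show False by simp
  qed
  then have "c \<le> dist ((T ^^ m) u) u" unfolding m_eq by (rule LeastI2_ex) blast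
  also have "\<dots> = 2 * dist u (midpt W ((T ^^ m) u) u)"
    using dist_midpt_left[OF W, of u "(T ^^ m) u"] midpt_commute[OF W, of u] by (simp add: dist_commute)
  also have "midpt W ((T ^^ m) u) u = avg_map W \<eta> b k T u"
    using False by (simp add: avg_map_def m_def)
  finally have "(2 + k 1) * c \<le> (2 + k 1) * (2 * dist u (avg_map W \<eta> b k T u))"
    using k1 by (intro mult_left_mono) auto
  moreover have "(2 + k 1) * c = dist u (T u)" using k1 by (simp add: c_def dist_commute)
  ultimately show ?thesis by (simp add: algebra_simps)
qed

lemma Fix_avg_map:
  fixes W :: "'a::metric_space \<Rightarrow> 'a \<Rightarrow> real \<Rightarrow> 'a" and T :: "'a \<Rightarrow> 'a"
  assumes "UCW_hyperbolic W \<eta>" and "b > 0"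
    and "\<forall>n. k n \<ge> 0" "k \<longlonglongrightarrow> 0" and "asymp_nonexpansive k T"
  shows "Fix (avg_map W \<eta> b k T) = Fix T"
proof -
  have "avg_map W \<eta> b k T u = u \<longleftrightarrow> T u = u" for u
  proof
    show "T u = u" if "avg_map W \<eta> b k T u = u"
      using avg_map_displacement[OF assms, of u] that by simp
  qed (simp add: avg_map_def)
  then show ?thesis by (simp add: Fix_def)
qed

lemma avg_map_demiclosed:
  fixes W :: "'a::metric_space \<Rightarrow> 'a \<Rightarrow> real \<Rightarrow> 'a" and T :: "'a \<Rightarrow> 'a"
  assumes "UCW_hyperbolic W \<eta>" and "b > 0"
    and "\<forall>n. k n \<ge> 0" "k \<longlonglongrightarrow> 0" and T: "asymp_nonexpansive k T"
    and u: "u \<longlonglongrightarrow> w" and disp: "(\<lambda>n. dist (u n) (avg_map W \<eta> b k T (u n))) \<longlonglongrightarrow> 0"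
  shows "w \<in> Fix (avg_map W \<eta> b k T)"
proof -
  have "(\<lambda>n. 2 * (2 + k 1) * dist (u n) (avg_map W \<eta> b k T (u n))) \<longlonglongrightarrow> 0"
    by (intro tendsto_mult_right_zero disp)
  then have "(\<lambda>n. dist (u n) (T (u n))) \<longlonglongrightarrow> 0"
    by (rule Lim_null_comparison[rotated]) (use avg_map_displacement[OF assms(1-5)] in auto)
  moreover have "(\<lambda>n. dist (u n) (T (u n))) \<longlonglongrightarrow> dist w (T w)"
    by (rule tendsto_dist[OF u asymp_nonexpansive_tendsto[OF T u]])
  ultimately have "dist w (T w) = 0" by (rule LIMSEQ_unique[rotated])
  then show ?thesis unfolding Fix_avg_map[OF assms(1-5)] by (simp add: Fix_def)
qed

section \<open>The stages settle\<close>

text \<open>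
  The last position that the next stage keeps; the new entry is appended behind it.
\<close>

definition branch :: "('a::metric_space \<Rightarrow> 'a \<Rightarrow> real \<Rightarrow> 'a) \<Rightarrow> ('a \<Rightarrow> 'a) \<Rightarrow> 'a list \<Rightarrow> nat" where
  "branch W S zs = (if \<exists>i. cut_at W S zs i then LEAST i. cut_at W S zs i else length zs)"

lemma next_stage_branch:
  "next_stage W S zs =
     take (branch W S zs) zs @ [midpt W (entry zs (branch W S zs)) (S (entry zs (length zs)))]"
  by (simp add: next_stage_def branch_def Let_def)

lemma branch_cases:
  obtains (cut) "cut_at W S zs (branch W S zs)"
  | (extend) "branch W S zs = length zs"
proof (cases "\<exists>i. cut_at W S zs i")
  case True
  then have "cut_at W S zs (LEAST i. cut_at W S zs i)" by (rule LeastI_ex)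
  with True show ?thesis by (intro cut) (simp add: branch_def)
next
  case False
  then show ?thesis by (intro extend) (simp add: branch_def)
qed

lemma branch_le_cut: "cut_at W S zs i \<Longrightarrow> branch W S zs \<le> i"
  unfolding branch_def by (auto intro: Least_le)

lemma branch_le_length: "branch W S zs \<le> length zs"
  by (rule branch_cases[of W S zs]) (auto simp: cut_at_def)

lemma branch_pos: "zs \<noteq> [] \<Longrightarrow> 1 \<le> branch W S zs"
  by (rule branch_cases[of W S zs]) (auto simp: cut_at_def Suc_le_eq)

locale stages =
  fixes W :: "'a::metric_space \<Rightarrow> 'a \<Rightarrow> real \<Rightarrow> 'a" and S :: "'a \<Rightarrow> 'a" and x0 :: 'a
begin

abbreviation m :: "nat \<Rightarrow> nat" where "m \<equiv> m_len W S x0"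
abbreviation z :: "nat \<Rightarrow> nat \<Rightarrow> 'a" where "z \<equiv> z_ent W S x0"
abbreviation y :: "nat \<Rightarrow> 'a" where "y \<equiv> y_seq W S x0"
abbreviation p :: "nat \<Rightarrow> nat" where "p \<equiv> p_idx W S x0"
abbreviation xs :: "nat \<Rightarrow> 'a" where "xs \<equiv> x_seq W S x0"

definition cut :: "nat \<Rightarrow> nat \<Rightarrow> bool" where
  "cut j i \<longleftrightarrow> 2 \<le> i \<and> i < m j \<and> dist (z i j) (z (i + 1) j) < dist (z i j) (z (i - 1) j) \<and>
     dist (z i j) (z (i - 1) j) \<le> dist (z i j) (midpt W (z i j) (S (y j)))"

definition br :: "nat \<Rightarrow> nat" where
  "br j = branch W S (stage W S x0 j)"

lemma cut_at_stage: "cut_at W S (stage W S x0 j) i \<longleftrightarrow> cut j i"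
  by (auto simp: cut_at_def cut_def z_ent_def y_seq_def m_len_def)

lemma stage_Suc: "1 \<le> j \<Longrightarrow> stage W S x0 (Suc j) = next_stage W S (stage W S x0 j)"
  by (cases j) auto

lemma m_0 [simp]: "m 0 = 0" and m_1 [simp]: "m (Suc 0) = 1"
  by (simp_all add: m_len_def)

lemma br_le: "br j \<le> m j"
  by (simp add: br_def m_len_def branch_le_length)

lemma m_Suc: "1 \<le> j \<Longrightarrow> m (Suc j) = Suc (br j)"
  using br_le[of j] by (simp add: m_len_def stage_Suc next_stage_branch br_def)

lemma m_pos: "1 \<le> j \<Longrightarrow> 1 \<le> m j"
  by (cases j; cases "j - 1") (auto simp: m_Suc)

lemma br_pos: "1 \<le> j \<Longrightarrow> 1 \<le> br j"
  unfolding br_def using m_pos[of j] by (intro branch_pos) (auto simp: m_len_def)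

lemma z_keep: "\<lbrakk>1 \<le> j; 1 \<le> i; i \<le> br j\<rbrakk> \<Longrightarrow> z i (Suc j) = z i j"
  using br_le[of j]
  by (cases i) (auto simp: z_ent_def entry_def stage_Suc next_stage_branch nth_append br_def m_len_def)

lemma z_new: "1 \<le> j \<Longrightarrow> z (Suc (br j)) (Suc j) = midpt W (z (br j) j) (S (y j))"
  using br_le[of j]
  by (simp add: z_ent_def y_seq_def entry_def stage_Suc next_stage_branch nth_append br_def m_len_def)

lemma br_cut_or_extend: "cut j (br j) \<or> br j = m j"
  using branch_cases[of W S "stage W S x0 j"] by (auto simp: br_def m_len_def cut_at_stage)

lemma br_le_cut: "cut j i \<Longrightarrow> br j \<le> i"
  by (simp add: br_def branch_le_cut cut_at_stage)

text \<open>
  A cut at position \<open>k\<close> replaces a step shorter than the preceding one by a step at least as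
  long, and this stays so until some earlier position is cut. So between two changes of the
  first \<open>k\<close> entries there is at most one cut at \<open>k\<close>, and by induction every position is cut
  only finitely often.
\<close>

lemma br_eventually_ge: "\<exists>J\<ge>1. \<forall>j\<ge>J. k \<le> br j"
proof (induction k)
  case (Suc k)
  then obtain J where J: "1 \<le> J" and ge: "\<And>j. j \<ge> J \<Longrightarrow> k \<le> br j" by blast
  show ?case
  proof (cases "\<exists>j>J. br j = k")
    case False
    then have "\<forall>j\<ge>Suc J. Suc k \<le> br j" using ge by (metis Suc_le_eq Suc_leD le_neq_implies_less)
    then show ?thesis by (intro exI[of _ "Suc J"]) auto
  next
    case True
    then obtain j0 where j0: "J < j0" "br j0 = k" by blast
    then obtain j1 where j1: "j0 = Suc j1" "J \<le> j1" by (cases j0) auto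
    have "k < m j0" using m_Suc[of j1] ge[of j1] j1 J by simp
    then have cut: "cut j0 k" using br_cut_or_extend[of j0] j0 by simp
    then have "2 \<le> k" by (simp add: cut_def)
    have advance: "k < br j" if "J < j" "dist (z k j) (z (k - 1) j) \<le> dist (z k j) (z (k + 1) j)" for j
    proof -
      obtain i where i: "j = Suc i" "J \<le> i" using \<open>J < j\<close> by (cases j) auto
      have "k < m j" using m_Suc[of i] ge[of i] i J by simp
      moreover have "\<not> cut j k" using that(2) by (simp add: cut_def)
      ultimately have "br j \<noteq> k" using br_cut_or_extend[of j] by auto
      then show ?thesis using ge[of j] \<open>J < j\<close> by simp
    qed
    have long: "dist (z k j) (z (k - 1) j) \<le> dist (z k j) (z (k + 1) j)" if "Suc j0 \<le> j" for j
      using that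
    proof (induction j rule: dec_induct)
      case base
      have "z (k + 1) (Suc j0) = midpt W (z k j0) (S (y j0))"
        using z_new[of j0] j0 J by simp
      moreover have "z k (Suc j0) = z k j0" "z (k - 1) (Suc j0) = z (k - 1) j0"
        using j0 J \<open>2 \<le> k\<close> by (auto intro!: z_keep)
      ultimately show ?case using cut by (simp add: cut_def)
    next
      case (step j)
      have "k < br j" using advance[of j] step j0 by simp
      then have "z k (Suc j) = z k j" "z (k - 1) (Suc j) = z (k - 1) j" "z (k + 1) (Suc j) = z (k + 1) j"
        using step.hyps \<open>2 \<le> k\<close> by (auto intro!: z_keep)
      with step.IH show ?case by simp
    qed
    have "Suc k \<le> br j" if "Suc j0 \<le> j" for j
      using advance[OF _ long[OF that]] that j0 by simp
    then show ?thesis by (intro exI[of _ "Suc j0"]) auto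
  qed
qed auto

lemma br_ge_of_m:
  assumes "1 \<le> j" "\<And>j'. j < j' \<Longrightarrow> k < m j'" "j \<le> j'"
  shows "k \<le> br j'"
  using assms(2)[of "Suc j'"] m_Suc[of j'] assms(1,3) by simp

lemma z_stable:
  assumes "1 \<le> j" "\<And>j'. j < j' \<Longrightarrow> k < m j'" "j \<le> j'" "1 \<le> i" "i \<le> k"
  shows "z i j' = z i j"
  using assms(3)
proof (induction j' rule: dec_induct)
  case (step n)
  have "k \<le> br n" using br_ge_of_m[OF assms(1,2)] step.hyps by simp
  with step assms show ?case using z_keep[of n i] by simp
qed simp

text \<open>
  The index \<open>p_idx k\<close> is the last stage of length \<open>k\<close>. It exists because lengths tend to
  infinity and grow by at most one per stage.
\<close>

lemma settling_exists: "\<exists>q. settling W S x0 q"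
proof -
  define q where "q k = Max {j. m j \<le> k}" for k
  have fin: "finite {j. m j \<le> k}" for k
  proof -
    obtain J where J: "1 \<le> J" "\<And>j. j \<ge> J \<Longrightarrow> k \<le> br j" using br_eventually_ge by blast
    have "j \<le> J" if "m j \<le> k" for j
    proof (rule ccontr)
      assume "\<not> j \<le> J"
      then have "J \<le> j - 1" "Suc (j - 1) = j" by auto
      with J(2)[of "j - 1"] m_Suc[of "j - 1"] J(1) that show False by simp
    qed
    then show ?thesis by (auto intro: finite_subset[OF _ finite_atMost[of J]])
  qed
  have mq: "m (q k) \<le> k" for k
  proof -
    have "0 \<in> {j. m j \<le> k}" by simp
    then have "q k \<in> {j. m j \<le> k}" unfolding q_def using Max_in[OF fin] by blast
    then show ?thesis by simp
  qed
  have after: "k < m j" if "q k < j" for k j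
  proof (rule ccontr)
    assume "\<not> k < m j"
    then show False using Max_ge[OF fin, of j k] that by (simp add: q_def)
  qed
  have growth: "m (Suc j) \<le> Suc (m j)" for j
    by (cases "j = 0") (use m_Suc[of j] br_le[of j] in auto)
  have mq_eq: "m (q k) = k" for k
    using mq[of k] after[of k "Suc (q k)"] growth[of "q k"] by simp
  have mq_Suc: "m (Suc (q k)) = Suc k" for k
    using after[of k "Suc (q k)"] growth[of "q k"] by (simp add: mq_eq)
  have "q k < q (Suc k)" for k
    using Max_ge[OF fin, of "Suc (q k)" "Suc k"] mq_Suc[of k] unfolding q_def by auto
  then have mono: "strict_mono q" by (rule strict_monoI_Suc)
  have q_pos: "1 \<le> q k" if "1 \<le> k" for k
    using mq_eq[of k] that by (cases "q k") auto
  have q1: "q 1 = 1"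
  proof (rule antisym)
    show "q 1 \<le> 1"
    proof (rule ccontr)
      assume "\<not> q 1 \<le> 1"
      then have "Suc (q 1 - 1) = q 1" "1 \<le> q 1 - 1" by auto
      then show False using m_Suc[of "q 1 - 1"] br_pos[of "q 1 - 1"] mq_eq[of 1] by simp
    qed
  qed (rule q_pos, simp)
  \<comment> \<open>A cut strictly lengthens the step that it replaces, so it changes the entry.\<close>
  have fresh: "m (q k - 1) < k \<or> z k (q k - 1) \<noteq> z k (q k)" if k: "1 \<le> k" for k
  proof (cases "k = 1")
    case True
    with q1 show ?thesis by simp
  next
    case False
    define j where "j = q k - 1"
    have "1 < q k" using False k q1 strict_monoD[OF mono, of 1 k] by simp
    then have j: "1 \<le> j" "Suc j = q k" by (auto simp: j_def)
    have brj: "k = Suc (br j)" using m_Suc[OF j(1)] mq_eq[of k] j by simp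
    show ?thesis
    proof (cases "br j = m j")
      case True
      with brj show ?thesis by (simp add: j_def)
    next
      case False
      then have "cut j (br j)" using br_cut_or_extend by blast
      then have "dist (z (br j) j) (z k j) < dist (z (br j) j) (z k (q k))"
        using z_new[OF j(1)] brj j(2) by (auto simp: cut_def)
      then show ?thesis by (auto simp: j_def)
    qed
  qed
  have "z k j = z k (q k)" if "1 \<le> k" "q k < j" for k j
    using z_stable[of "q k" k j k] after that q_pos[of k] by simp
  with q1 mono mq_eq after fresh show ?thesis
    unfolding settling_def by (intro exI[of _ q]) (auto simp: Suc_le_eq)
qed

lemma settling_unique:
  assumes "settling W S x0 q" "settling W S x0 q'"
  shows "q = q'"
proof -
  have le: "q1 k \<le> q2 k" if "settling W S x0 q1" "settling W S x0 q2" for q1 q2 k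
  proof (cases "k = 0")
    case True
    have "strict_mono q1" "q1 1 = 1" using that(1) unfolding settling_def by blast+
    then show ?thesis using strict_monoD[of q1 0 1] True by simp
  next
    case False
    have "m (q1 k) = k" "\<And>j. j \<ge> q2 k + 1 \<Longrightarrow> k + 1 \<le> m j"
      using that False unfolding settling_def by auto
    then show ?thesis by (metis Suc_eq_plus1 Suc_n_not_le_n not_less_eq_eq)
  qed
  show ?thesis by (intro ext antisym le assms)
qed

lemma settling_p: "settling W S x0 p"
  unfolding p_idx_def using settling_exists settling_unique by (metis theI)

lemma p_1: "p 1 = 1" and p_strict_mono: "strict_mono p"
  using settling_p by (auto simp: settling_def)

lemma m_p: "1 \<le> k \<Longrightarrow> m (p k) = k"
  using settling_p by (auto simp: settling_def)

lemma m_after_p: "\<lbrakk>1 \<le> k; p k < j\<rbrakk> \<Longrightarrow> k < m j"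
  using settling_p by (auto simp: settling_def Suc_le_eq)

lemma p_pos: "1 \<le> k \<Longrightarrow> 1 \<le> p k"
  using p_1 strict_mono_less_eq[OF p_strict_mono, of 1 k] by simp

lemma x_eq_y: "xs k = y (p k)"
  by (simp add: x_seq_def)

lemma z_eq_x:
  assumes "1 \<le> k" "p k \<le> j"
  shows "z k j = xs k"
  using z_stable[of "p k" k j k] m_after_p[of k] p_pos[of k] assms
  by (simp add: x_eq_y y_seq_def m_p)

text \<open>
  Stage \<open>p (k + 1)\<close> has length \<open>k + 1\<close>, so its last entry has just been created. At that time
  entry \<open>k\<close> has settled, because \<open>p\<close> is strictly increasing.
\<close>

lemma last_step:
  assumes "1 \<le> k"
  obtains j where "p (Suc k) = Suc j" "p k \<le> j" "br j = k"
    and "xs (Suc k) = midpt W (xs k) (S (y j))"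
proof -
  have "p k < p (Suc k)" using strict_monoD[OF p_strict_mono, of k "Suc k"] by simp
  then obtain j where j: "p (Suc k) = Suc j" "p k \<le> j" by (cases "p (Suc k)") auto
  have j1: "1 \<le> j" using p_pos[OF assms] j by simp
  have br: "br j = k" using m_Suc[OF j1] m_p[of "Suc k"] j by simp
  have "xs (Suc k) = midpt W (xs k) (S (y j))"
    using z_new[OF j1] z_eq_x[of "Suc k" "Suc j"] z_eq_x[OF assms j(2)] br j by simp
  with j br show ?thesis by (rule that)
qed

text \<open>
  A cut inserts a step at least as long as its predecessor, so a shorter one comes from the
  extension of a stage. That stage has length \<open>k\<close> and comes no earlier than \<open>p k\<close>, so it is
  \<open>p k\<close> itself, which ends with \<open>xs k\<close>.
\<close>

lemma shorter_step_uncut: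
  assumes k: "2 \<le> k" and short: "dist (xs k) (xs (k + 1)) < dist (xs k) (xs (k - 1))"
  shows "xs (k + 1) = midpt W (xs k) (S (xs k))"
proof -
  have k1: "1 \<le> k" using k by simp
  obtain j where j: "p (Suc k) = Suc j" "p k \<le> j" "br j = k"
    and step: "xs (Suc k) = midpt W (xs k) (S (y j))"
    using last_step[OF k1] .
  have "p (k - 1) \<le> j" using j(2) strict_mono_less_eq[OF p_strict_mono, of "k - 1" k] by simp
  then have "\<not> cut j k"
    using z_eq_x[OF k1 j(2)] z_eq_x[of "k - 1" j] k short step by (auto simp: cut_def)
  then have "m j = k" using br_cut_or_extend[of j] j(3) by simp
  then have "j = p k" using m_after_p[OF k1, of j] j(2) by fastforce
  with step show ?thesis by (simp add: x_eq_y)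
qed

text \<open>
  A short step that has become final is never cut again, and the only condition for a cut that
  can still fail is the one on \<open>S (y j)\<close>.
\<close>

lemma shorter_step_confines:
  assumes k: "2 \<le> k" and short: "dist (xs k) (xs (k + 1)) < dist (xs k) (xs (k - 1))"
    and j: "p (k + 1) \<le> j"
  shows "dist (xs k) (midpt W (xs k) (S (y j))) < dist (xs k) (xs (k - 1))"
proof (rule ccontr)
  assume "\<not> ?thesis"
  moreover have "p (k - 1) \<le> j" "p k < j"
    using j strict_mono_less_eq[OF p_strict_mono, of "k - 1" "k + 1"]
      strict_monoD[OF p_strict_mono, of k "k + 1"] by auto
  ultimately have "cut j k"
    using z_eq_x[of k j] z_eq_x[of "k - 1" j] z_eq_x[of "k + 1" j] m_after_p[of k j] k short j
    by (auto simp: cut_def)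
  then have "m (Suc j) \<le> Suc k"
    using br_le_cut m_Suc[of j] p_pos[of "k + 1"] j by simp
  then show False using m_after_p[of "k + 1" "Suc j"] j by simp
qed

section \<open>Convergence\<close>

text \<open>
  Each entry after the first is the midpoint of its predecessor and the image of the last entry
  of some earlier stage. That stage contained the predecessor, so by induction its last entry
  is no farther from the fixed point \<open>q\<close> than the predecessor.
\<close>

lemma stage_fejer:
  assumes W: "W_hyperbolic W" and q: "\<And>u. dist (S u) q \<le> dist u q"
    and "1 \<le> j" "1 \<le> i" "i \<le> i'" "i' \<le> m j"
  shows "dist (z i' j) q \<le> dist (z i j) q"
  using assms(3-)
proof (induction j arbitrary: i i' rule: dec_induct)
  case base
  then have "i' = i" by simp
  then show ?case by simp
next
  case (step j)
  show ?case
  proof (cases "i' = Suc (br j)")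
    case False
    then have "i' \<le> br j" using step.prems step.hyps m_Suc[of j] by simp
    moreover have "br j \<le> m j" by (rule br_le)
    ultimately show ?thesis
      using step.IH[of i i'] step.prems step.hyps z_keep[of j i] z_keep[of j i'] by simp
  next
    case i': True
    show ?thesis
    proof (cases "i = i'")
      case False
      then have i: "i \<le> br j" using i' step.prems by simp
      have "dist q (z i' (Suc j)) \<le> (dist q (z (br j) j) + dist q (S (y j))) / 2"
        using dist_midpt_le[OF W] z_new[of j] step.hyps i' by simp
      moreover have "dist (z (br j) j) q \<le> dist (z i j) q"
        using step.IH[of i "br j"] step.prems i br_le[of j] by simp
      moreover have "dist (S (y j)) q \<le> dist (z i j) q"
        using q[of "y j"] step.IH[of i "m j"] step.prems i br_le[of j] unfolding y_seq_def by simp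
      moreover have "z i (Suc j) = z i j" using z_keep[of j i] step.prems step.hyps i by simp
      ultimately show ?thesis by (simp add: dist_commute)
    qed simp
  qed
qed

lemma y_fejer:
  assumes W: "W_hyperbolic W" and q: "\<And>u. dist (S u) q \<le> dist u q"
    and k: "1 \<le> k" and j: "p k \<le> j"
  shows "dist (y j) q \<le> dist (xs k) q"
proof -
  have "k \<le> m j" using m_p[OF k] m_after_p[OF k, of j] j by (cases "j = p k") auto
  then have "dist (z (m j) j) q \<le> dist (z k j) q"
    using stage_fejer[OF W q, of j k "m j"] p_pos[OF k] j k by simp
  then show ?thesis using z_eq_x[OF k j] by (simp add: y_seq_def)
qed

text \<open>
  Fejer monotonicity bounds the distance from \<open>q\<close> for all later terms, so a single term close to
  \<open>q\<close> is enough for each \<open>e\<close>.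
\<close>

lemma convergence_of_approach:
  assumes W: "W_hyperbolic W" and q: "\<And>u. dist (S u) q \<le> dist u q"
    and approach: "\<And>e. 0 < e \<Longrightarrow> \<exists>k\<ge>1. dist (xs k) q < e"
  shows "xs \<longlonglongrightarrow> q" and "y \<longlonglongrightarrow> q"
proof -
  show y: "y \<longlonglongrightarrow> q"
  proof (rule metric_LIMSEQ_I)
    fix e :: real assume "0 < e"
    then obtain k where k: "1 \<le> k" "dist (xs k) q < e" using approach by blast
    have "dist (y j) q < e" if "p k \<le> j" for j
      using y_fejer[OF W q k(1) that] k(2) by simp
    then show "\<exists>N. \<forall>j\<ge>N. dist (y j) q < e" by blast
  qed
  have "xs = y \<circ> p" by (auto simp: x_eq_y)
  then show "xs \<longlonglongrightarrow> q" using LIMSEQ_subseq_LIMSEQ[OF y p_strict_mono] by simp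
qed

text \<open>
  A step of length at least \<open>d\<close> halves a segment of length at least \<open>2 * d\<close> between two
  points in the ball around \<open>q\<close>, so by uniform convexity it brings the sequence nearer to \<open>q\<close>
  by a fixed amount, as long as the distance to \<open>q\<close> stays away from zero.
\<close>

lemma steps_vanish:
  assumes ucw: "UCW_hyperbolic W \<eta>" and q: "\<And>u. dist (S u) q \<le> dist u q"
    and "0 < c" and away: "\<And>k. 1 \<le> k \<Longrightarrow> c \<le> dist (xs k) q"
  shows "(\<lambda>k. dist (xs k) (xs (Suc k))) \<longlonglongrightarrow> 0"
proof (rule metric_LIMSEQ_I)
  fix d :: real assume "0 < d"
  have W: "W_hyperbolic W" using ucw by (simp add: UCW_hyperbolic_def)
  define a where "a k = dist (xs (Suc k)) q" for k
  have dec: "decseq a"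
    unfolding a_def
  proof (rule decseq_SucI)
    fix n
    show "dist (xs (Suc (Suc n))) q \<le> dist (xs (Suc n)) q"
      using y_fejer[OF W q, of "Suc n" "p (Suc (Suc n))"] strict_mono_less_eq[OF p_strict_mono]
      by (simp add: x_eq_y[of "Suc (Suc n)"])
  qed
  obtain l where l: "a \<longlonglongrightarrow> l"
    using decseq_convergent[OF dec, of 0] by (auto simp: a_def)
  have drop: "(\<lambda>k. a k - a (Suc k)) \<longlonglongrightarrow> 0"
    using tendsto_diff[OF l LIMSEQ_Suc[OF l]] by simp
  define R where "R = dist (xs 1) q"
  define \<epsilon> where "\<epsilon> = 2 * d / R"
  have "0 < R" using away[of 1] \<open>0 < c\<close> unfolding R_def by linarith
  then have \<epsilon>: "0 < \<epsilon>" "\<epsilon> * R = 2 * d" using \<open>0 < d\<close> by (auto simp: \<epsilon>_def)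
  have h: "0 < \<eta> R \<epsilon>" by (rule modulus_pos[OF ucw \<open>0 < R\<close> \<epsilon>(1)])
  have long: "\<eta> R \<epsilon> * c \<le> dist (xs k) q - dist (xs (Suc k)) q"
    if k: "1 \<le> k" and far: "d \<le> dist (xs k) (xs (Suc k))" for k
  proof -
    obtain j where j: "p k \<le> j" and step: "xs (Suc k) = midpt W (xs k) (S (y j))"
      using last_step[OF k] by metis
    define r where "r = dist (xs k) q"
    have r: "c \<le> r" using away[OF k] by (simp add: r_def)
    have "r \<le> R"
      using decseqD[OF dec, of 0 "k - 1"] k by (simp add: r_def R_def a_def)
    have "dist (S (y j)) q \<le> r"
      using q[of "y j"] y_fejer[OF W q k j] by (simp add: r_def)
    moreover have "\<epsilon> * R \<le> dist (xs k) (S (y j))"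
      using far dist_midpt_left[OF W, of "xs k" "S (y j)"] step \<epsilon>(2) by simp
    ultimately have "dist (xs (Suc k)) q \<le> (1 - \<eta> R \<epsilon>) * r"
      unfolding step using r \<open>0 < c\<close>
      by (intro midpt_contraction[OF ucw _ \<open>r \<le> R\<close> \<epsilon>(1)]) (auto simp: r_def)
    moreover have "\<eta> R \<epsilon> * c \<le> \<eta> R \<epsilon> * r" using r h by simp
    ultimately show ?thesis unfolding r_def[symmetric] by (simp add: algebra_simps)
  qed
  have "0 < \<eta> R \<epsilon> * c" using h \<open>0 < c\<close> by simp
  from order_tendstoD(2)[OF drop this]
  obtain N where N: "\<And>k. N \<le> k \<Longrightarrow> a k - a (Suc k) < \<eta> R \<epsilon> * c"
    by (auto simp: eventually_sequentially)
  have "dist (xs k) (xs (Suc k)) < d" if "Suc N \<le> k" for k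
    using long[of k] N[of "k - 1"] that by (cases k) (force simp: a_def)+
  then show "\<exists>N. \<forall>k\<ge>N. dist (dist (xs k) (xs (Suc k))) 0 < d"
    by (intro exI[of _ "Suc N"]) simp
qed

end

text \<open>
  Either some given fixed point is approached, or the steps of \<open>x_seq\<close> tend to zero. In the latter
  case, if infinitely many steps are shorter than their predecessors, each of them confines all
  later \<open>S (y j)\<close> to a ball around its starting point, with radius tending to zero; so
  these values converge, the starting points have the same limit, and their displacements
  tend to zero. Otherwise the step lengths are eventually nondecreasing, hence zero.
\<close>

lemma stages_converge:
  fixes W :: "'a::complete_space \<Rightarrow> 'a \<Rightarrow> real \<Rightarrow> 'a"
  assumes ucw: "UCW_hyperbolic W \<eta>" and ne: "Fix S \<noteq> {}"
    and fejer: "\<And>q u. q \<in> Fix S \<Longrightarrow> dist (S u) q \<le> dist u q"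
    and closed: "\<And>u w. \<lbrakk>u \<longlonglongrightarrow> w; (\<lambda>n. dist (u n) (S (u n))) \<longlonglongrightarrow> 0\<rbrakk> \<Longrightarrow> w \<in> Fix S"
  shows "\<exists>q\<in>Fix S. x_seq W S x \<longlonglongrightarrow> q \<and> y_seq W S x \<longlonglongrightarrow> q"
proof -
  interpret stages W S x .
  have W: "W_hyperbolic W" using ucw by (simp add: UCW_hyperbolic_def)
  have suffices: ?thesis if "q \<in> Fix S" "\<And>e. 0 < e \<Longrightarrow> \<exists>k\<ge>1. dist (xs k) q < e" for q
    using convergence_of_approach[OF W fejer[OF that(1)] that(2)] that(1) by blast
  obtain q0 where q0: "q0 \<in> Fix S" using ne by blast
  show ?thesis
  proof (cases "\<forall>e>0. \<exists>k\<ge>1. dist (xs k) q0 < e")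
    case True
    then show ?thesis using suffices[OF q0] by blast
  next
    case False
    then obtain c where c: "0 < c" "\<And>k. 1 \<le> k \<Longrightarrow> c \<le> dist (xs k) q0" by (auto simp: not_less)
    have steps: "(\<lambda>k. dist (xs k) (xs (Suc k))) \<longlonglongrightarrow> 0"
      by (rule steps_vanish[OF ucw fejer[OF q0] c])
    define short where "short k \<longleftrightarrow> 2 \<le> k \<and> dist (xs k) (xs (k + 1)) < dist (xs k) (xs (k - 1))" for k
    show ?thesis
    proof (cases "\<forall>N. \<exists>k\<ge>N. short k")
      case True
      then obtain K where K: "\<And>n. n \<le> K n" "\<And>n. short (K n)" by metis
      have K2: "2 \<le> K n" for n using K(2) by (simp add: short_def)
      have K_top: "filterlim K at_top sequentially"
        by (rule filterlim_at_top_mono[OF filterlim_ident]) (use K(1) in auto)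
      define \<delta> where "\<delta> n = 2 * dist (xs (K n)) (xs (K n - 1))" for n
      have "filterlim (\<lambda>n. K n - 1) at_top sequentially"
        by (rule filterlim_compose[OF filterlim_minus_const_nat_at_top K_top])
      from tendsto_mult_right_zero[OF filterlim_compose[OF steps this], of 2]
      have "(\<lambda>n. 2 * dist (xs (K n - 1)) (xs (Suc (K n - 1)))) \<longlonglongrightarrow> 0" .
      moreover have "Suc (K n - 1) = K n" for n using K2[of n] by simp
      ultimately have \<delta>: "\<delta> \<longlonglongrightarrow> 0" by (simp only: \<delta>_def[abs_def] dist_commute[of "xs (K _)"])
      have conf: "dist (xs (K n)) (S (y j)) < \<delta> n" if "p (K n + 1) \<le> j" for n j
        using shorter_step_confines[of "K n" j] K(2)[of n] that dist_midpt_left[OF W, of "xs (K n)"]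
        by (simp add: \<delta>_def short_def)
      have "Cauchy (\<lambda>j. S (y j))"
      proof (rule metric_CauchyI)
        fix e :: real assume "0 < e"
        then obtain n where n: "\<delta> n < e / 2"
          using order_tendstoD(2)[OF \<delta>, of "e / 2"] by (auto simp: eventually_sequentially)
        have "dist (S (y i)) (S (y j)) < e" if "p (K n + 1) \<le> i" "p (K n + 1) \<le> j" for i j
          using dist_triangle3[of "S (y i)" "S (y j)" "xs (K n)"] conf[OF that(1)] conf[OF that(2)] n
          by linarith
        then show "\<exists>M. \<forall>i\<ge>M. \<forall>j\<ge>M. dist (S (y i)) (S (y j)) < e" by blast
      qed
      then obtain q where q: "(\<lambda>j. S (y j)) \<longlonglongrightarrow> q"
        using Cauchy_convergent by (auto simp: convergent_def)
      have "dist (xs (K n)) q \<le> \<delta> n" for n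
      proof (rule LIMSEQ_le_const2[OF tendsto_dist[OF tendsto_const q]])
        show "\<exists>N. \<forall>j\<ge>N. dist (xs (K n)) (S (y j)) \<le> \<delta> n"
          using conf[of n] by (intro exI[of _ "p (K n + 1)"]) (auto intro: less_imp_le)
      qed
      then have "(\<lambda>n. dist (xs (K n)) q) \<longlonglongrightarrow> 0"
        by (intro Lim_null_comparison[OF _ \<delta>]) auto
      then have lim: "(\<lambda>n. xs (K n)) \<longlonglongrightarrow> q" using tendsto_dist_iff by blast
      have "dist (xs (K n)) (S (xs (K n))) = 2 * dist (xs (K n)) (xs (Suc (K n)))" for n
        using shorter_step_uncut[of "K n"] K(2)[of n] dist_midpt_left[OF W, of "xs (K n)" "S (xs (K n))"]
        by (simp add: short_def)
      then have "(\<lambda>n. dist (xs (K n)) (S (xs (K n)))) \<longlonglongrightarrow> 0"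
        using tendsto_mult_right_zero[OF filterlim_compose[OF steps K_top], of 2] by simp
      from closed[OF lim this] have qF: "q \<in> Fix S" .
      show ?thesis
      proof (rule suffices[OF qF])
        fix e :: real assume "0 < e"
        with tendstoD[OF lim] obtain n where "dist (xs (K n)) q < e"
          by (auto simp: eventually_sequentially)
        with K2[of n] show "\<exists>k\<ge>1. dist (xs k) q < e" by (intro exI[of _ "K n"]) simp
      qed
    next
      case False
      then obtain N where N: "\<And>k. N \<le> k \<Longrightarrow> \<not> short k" by blast
      define M where "M = max N 2"
      define a where "a k = dist (xs (M + k)) (xs (Suc (M + k)))" for k
      have "incseq a"
      proof (rule incseq_SucI)
        fix k
        show "a k \<le> a (Suc k)"
          using N[of "Suc (M + k)"] by (simp add: short_def a_def M_def not_less dist_commute)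
      qed
      moreover have "a \<longlonglongrightarrow> 0"
        using LIMSEQ_ignore_initial_segment[OF steps, of M] by (simp add: a_def[abs_def] add.commute)
      ultimately have "a k \<le> 0" for k by (rule incseq_le)
      then have const: "xs (Suc (M + k)) = xs (M + k)" for k by (simp add: a_def)
      obtain j where j: "p (Suc (Suc M)) = Suc j" "p (Suc M) \<le> j" "br j = Suc M"
        and step: "xs (Suc (Suc M)) = midpt W (xs (Suc M)) (S (y j))"
        using last_step[of "Suc M"] by auto
      have Mj: "p M \<le> j" using j(2) strict_mono_less_eq[OF p_strict_mono, of M "Suc M"] by simp
      \<comment> \<open>A cut replaces a step shorter than its predecessor, but here the predecessor has length zero.\<close>
      have "\<not> cut j (Suc M)"
        using z_eq_x[OF _ j(2)] z_eq_x[OF _ Mj] const[of 0] by (auto simp: cut_def M_def)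
      then have "m j = Suc M" using br_cut_or_extend[of j] j(3) by simp
      then have "j = p (Suc M)" using m_after_p[of "Suc M" j] j(2) by fastforce
      then have "xs (Suc M) = midpt W (xs (Suc M)) (S (xs (Suc M)))"
        using step const[of 1] by (simp add: x_eq_y)
      then have "S (xs (Suc M)) = xs (Suc M)"
        using dist_midpt_left[OF W, of "xs (Suc M)" "S (xs (Suc M))"] by simp
      then have "xs (Suc M) \<in> Fix S" by (simp add: Fix_def)
      then show ?thesis by (rule suffices) (intro exI[of _ "Suc M"], simp)
    qed
  qed
qed

theorem proposition3p14:
  fixes W :: "'a::complete_space \<Rightarrow> 'a \<Rightarrow> real \<Rightarrow> 'a"
    and \<eta> :: "real \<Rightarrow> real \<Rightarrow> real"
    and b :: real
    and k :: "nat \<Rightarrow> real"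
    and T S :: "'a \<Rightarrow> 'a"
    and x :: 'a
  assumes "UCW_hyperbolic W \<eta>"
    and "b > 0" and "\<forall>u v :: 'a. dist u v \<le> b"
    and "\<forall>n. k n \<ge> 0" and "k \<longlonglongrightarrow> 0"
    and "asymp_nonexpansive k T"
    and "S = avg_map W \<eta> b k T \<or>
           (Fix T = Fix S \<and>
            (\<forall>u w. u \<longlonglongrightarrow> w \<longrightarrow> (\<lambda>n. dist (u n) (S (u n))) \<longlonglongrightarrow> 0 \<longrightarrow> w \<in> Fix S))"
    and "\<forall>q\<in>Fix S. \<forall>u. dist (S u) q \<le> dist u q"
  shows "\<exists>p. x_seq W S x \<longlonglongrightarrow> p \<and> p \<in> Fix S \<and> Fix S = Fix T \<and> y_seq W S x \<longlonglongrightarrow> p"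
proof -
  note avg = assms(1,2,4,5,6)
  have Fix: "Fix S = Fix T"
    using assms(7) Fix_avg_map[OF avg] by blast
  have closed: "w \<in> Fix S" if "u \<longlonglongrightarrow> w" "(\<lambda>n. dist (u n) (S (u n))) \<longlonglongrightarrow> 0" for u w
    using assms(7)
  proof
    assume "S = avg_map W \<eta> b k T"
    then show ?thesis using avg_map_demiclosed[OF avg that(1)] that(2) by blast
  qed (use that in blast)
  have "Fix S \<noteq> {}"
    unfolding Fix by (rule Fix_nonempty[OF assms(1,3-6)])
  then have "\<exists>q\<in>Fix S. x_seq W S x \<longlonglongrightarrow> q \<and> y_seq W S x \<longlonglongrightarrow> q"
    using assms(8) closed by (intro stages_converge[OF assms(1)]) auto
  with Fix show ?thesis by blast
qed

end
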